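(* For $n\ge1$ let $\mathcal{C}_n$ be the collection of closed convex subsets of $\mathbb{R}^n$ which are symmetric about the origin. Suppose that for all $n\ge 1$ the inequality $\mu_n(A\cap B)\ge\mu_n(A)\mu_n(B)$ holds for all $A,B\in\mathcal{C}_n$ with $A,B\subset\sqrt n\,B_2^n$. Then $\mu_n(A\cap B)\ge\mu_n(A)\mu_n(B)$ holds for all $n\ge 1$ and all $A,B\in\mathcal{C}_n$.
   Context: $\mu_n$ denotes the standard Gaussian measure on $\mathbb{R}^n$, $\mu_n(A)=(2\pi)^{-n/2}\int_A e^{-|x|^2/2}\,dx$; $B_2^n=\{x\in\mathbb{R}^n:|x|\le1\}$ is the Euclidean unit ball. A set $A$ is symmetric about the origin if $A=-A$. *)

theory Defs
  imports "HOL-Analysis.Analysis"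
begin

text \<open>
  The dimension \<open>n\<close> is quantified inside a hypothesis, so \<open>\<real>\<^sup>n\<close> cannot be a type here.
  It is the set \<open>{..<n} \<rightarrow>\<^sub>E UNIV\<close> of extensional functions, which is both the topological
  space of \<open>powertop_real {..<n}\<close> and the space of \<open>Pi\<^sub>M {..<n} (\<lambda>_. lborel)\<close>.
\<close>

definition Rn :: "nat \<Rightarrow> (nat \<Rightarrow> real) set" where
  "Rn n = {..<n} \<rightarrow>\<^sub>E UNIV"

definition add_Rn :: "nat \<Rightarrow> (nat \<Rightarrow> real) \<Rightarrow> (nat \<Rightarrow> real) \<Rightarrow> (nat \<Rightarrow> real)" where
  "add_Rn n x y = (\<lambda>i\<in>{..<n}. x i + y i)"

definition scale_Rn :: "nat \<Rightarrow> real \<Rightarrow> (nat \<Rightarrow> real) \<Rightarrow> (nat \<Rightarrow> real)" where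
  "scale_Rn n c x = (\<lambda>i\<in>{..<n}. c * x i)"

definition norm_Rn :: "nat \<Rightarrow> (nat \<Rightarrow> real) \<Rightarrow> real" where
  "norm_Rn n x = L2_set x {..<n}"

definition ball_Rn :: "nat \<Rightarrow> (nat \<Rightarrow> real) set" where
  "ball_Rn n = {x \<in> Rn n. norm_Rn n x \<le> 1}"

definition convex_Rn :: "nat \<Rightarrow> (nat \<Rightarrow> real) set \<Rightarrow> bool" where
  "convex_Rn n A \<longleftrightarrow>
     (\<forall>x\<in>A. \<forall>y\<in>A. \<forall>u\<ge>0. \<forall>v\<ge>0. u + v = 1 \<longrightarrow>
        add_Rn n (scale_Rn n u x) (scale_Rn n v y) \<in> A)"

definition symmetric_Rn :: "nat \<Rightarrow> (nat \<Rightarrow> real) set \<Rightarrow> bool" where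
  "symmetric_Rn n A \<longleftrightarrow> A = scale_Rn n (- 1) ` A"

text \<open>\<open>closedin\<close> includes the condition \<open>A \<subseteq> Rn n\<close>.\<close>

definition sym_convex :: "nat \<Rightarrow> (nat \<Rightarrow> real) set set" where
  "sym_convex n =
     {A. closedin (powertop_real {..<n}) A \<and> convex_Rn n A \<and> symmetric_Rn n A}"

definition gauss :: "nat \<Rightarrow> (nat \<Rightarrow> real) measure" where
  "gauss n = density (Pi\<^sub>M {..<n} (\<lambda>_. lborel))
     (\<lambda>x. ennreal ((2 * pi) powr (- real n / 2) * exp (- (norm_Rn n x)\<^sup>2 / 2)))"

text \<open>
  Outside \<open>sets (gauss n)\<close> the function \<open>measure (gauss n)\<close> is \<open>0\<close> by convention; the next
  lemma shows that this convention never applies to the sets in \<open>sym_convex n\<close>.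
\<close>

lemma closedin_sets_gauss:
  assumes "closedin (powertop_real {..<n}) A"
  shows "A \<in> sets (gauss n)"
proof -
  let ?r = "\<lambda>x. restrict x {..<n} :: nat \<Rightarrow> real"
  let ?e = "\<lambda>x i. if i < n then x i else (0::real)"
  let ?M = "Pi\<^sub>M {..<n} (\<lambda>_. lborel :: real measure)"
  have A: "A \<subseteq> {..<n} \<rightarrow>\<^sub>E UNIV"
    using closedin_subset[OF assms] by simp
  have "continuous_map (powertop_real UNIV) (powertop_real {..<n}) ?r"
    by (auto simp: continuous_map_componentwise intro!: continuous_map_product_projection)
  from closedin_continuous_map_preimage[OF this assms]
  have "closed {x. ?r x \<in> A}"
    by (simp add: euclidean_product_topology)
  then have "{x. ?r x \<in> A} \<in> sets (borel :: (nat \<Rightarrow> real) measure)"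
    by (rule borel_closed)
  then have B: "{x. ?r x \<in> A} \<in> sets (Pi\<^sub>M UNIV (\<lambda>_. borel :: real measure))"
    by (simp only: sets_PiM_equal_borel)
  have "?e \<in> ?M \<rightarrow>\<^sub>M Pi\<^sub>M UNIV (\<lambda>_. borel)"
  proof (rule measurable_PiM_single')
    fix i :: nat
    show "(\<lambda>x. ?e x i) \<in> ?M \<rightarrow>\<^sub>M borel"
      by (cases "i < n") (auto intro: measurable_component_singleton[of i "{..<n}" "\<lambda>_. lborel", simplified])
  qed auto
  from measurable_sets[OF this B]
  have "?e -` {x. ?r x \<in> A} \<inter> space ?M \<in> sets ?M" .
  moreover have "?r (?e x) = x" if "x \<in> {..<n} \<rightarrow>\<^sub>E UNIV" for x
    using that by (auto simp: fun_eq_iff PiE_def extensional_def)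
  then have "?e -` {x. ?r x \<in> A} \<inter> space ?M = A"
    using A by (auto simp: space_PiM)
  ultimately show ?thesis
    by (simp add: gauss_def)
qed

end

theory Submission
  imports Defs "HOL-Probability.Probability"
begin

text \<open>
  For \<open>N = n + m\<close> the set \<open>(A \<times> \<real>\<^sup>m) \<inter> sqrt N B\<close> is admissible in the hypothesis. As \<open>m\<close> grows, its
  Gaussian measure stays above \<open>c \<mu>(A)\<close> for a universal \<open>c > 0\<close> (any \<open>c < 1/2\<close> would be possible),
  because \<open>\<bar>x\<bar>\<^sup>2 - N\<close> fluctuates on the scale \<open>sqrt N\<close> and the first \<open>n\<close> coordinates hardly affect it.
  This yields \<open>\<mu>(A \<inter> B) \<ge> c\<^sup>2 \<mu>(A) \<mu>(B)\<close> in all dimensions. Applying it to the powers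
  \<open>A \<times> \<dots> \<times> A\<close> and \<open>B \<times> \<dots> \<times> B\<close> and taking roots removes the constant.
\<close>

section \<open>Products of sets and the product structure of \<open>gauss\<close>\<close>

text \<open>Cartesian product re-indexed to lie in \<open>Rn (n + m)\<close>, with the second factor
  shifted by \<open>n\<close>, so that it can again be a member of
  \<open>sym_convex\<close>.\<close>

definition times_Rn ::
  "nat \<Rightarrow> nat \<Rightarrow> (nat \<Rightarrow> real) set \<Rightarrow> (nat \<Rightarrow> real) set \<Rightarrow> (nat \<Rightarrow> real) set" where
  "times_Rn n m A D =
     {x \<in> Rn (n + m). restrict x {..<n} \<in> A \<and> (\<lambda>i\<in>{..<m}. x (n + i)) \<in> D}"

text \<open>The parameter is the squared radius: it adds up under products, and a negative value
  gives the empty set, so \<open>real m - a\<close> is allowed for every \<open>a\<close>.\<close>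

definition sqball_Rn :: "nat \<Rightarrow> real \<Rightarrow> (nat \<Rightarrow> real) set" where
  "sqball_Rn n s = {x \<in> Rn n. (norm_Rn n x)\<^sup>2 \<le> s}"

lemma norm_Rn_power2: "(norm_Rn n x)\<^sup>2 = (\<Sum>i<n. (x i)\<^sup>2)"
  by (simp add: norm_Rn_def L2_set_def sum_nonneg)

text \<open>The density is a product of one-dimensional densities, so by Tonelli both measures agree
  on boxes, and boxes determine a product measure.\<close>

lemma gauss_eq_PiM: "gauss n = Pi\<^sub>M {..<n} (\<lambda>_. std_normal_distribution)"
proof -
  interpret S: prob_space std_normal_distribution
    by (rule prob_space_normal_density) simp
  interpret product_sigma_finite "\<lambda>_::nat. std_normal_distribution"
    by (simp add: product_sigma_finite_def S.sigma_finite_measure_axioms)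
  interpret L: product_sigma_finite "\<lambda>_::nat. lborel :: real measure"
    by (simp add: product_sigma_finite_def sigma_finite_lborel)
  show ?thesis
  proof (rule PiM_eqI)
    show "sets (gauss n) = sets (Pi\<^sub>M {..<n} (\<lambda>_. std_normal_distribution))"
      by (auto simp: gauss_def intro!: sets_PiM_cong)
    fix A :: "nat \<Rightarrow> real set"
    assume "\<And>i. i \<in> {..<n} \<Longrightarrow> A i \<in> sets std_normal_distribution"
    then have A: "\<And>i. i < n \<Longrightarrow> A i \<in> sets borel" by auto
    then have [measurable]: "Pi\<^sub>E {..<n} A \<in> sets (Pi\<^sub>M {..<n} (\<lambda>_. lborel))"
      by (intro sets_PiM_I_finite) auto
    have [measurable]: "(\<lambda>x. norm_Rn n x) \<in> borel_measurable (Pi\<^sub>M {..<n} (\<lambda>_. lborel))"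
      unfolding norm_Rn_def L2_set_def by measurable
    have dens: "(2 * pi) powr (- real n / 2) * exp (- (norm_Rn n x)\<^sup>2 / 2)
        = (\<Prod>i<n. std_normal_density (x i))" for x
    proof -
      have "(2 * pi) powr (- real n / 2) = (1 / sqrt (2 * pi)) ^ n"
      proof -
        have "1 / sqrt (2 * pi) = (2 * pi) powr (- 1 / 2)"
          using powr_minus_divide[of "2 * pi" "1 / 2"] by (simp add: powr_half_sqrt)
        then have "(1 / sqrt (2 * pi)) ^ n = ((2 * pi) powr (- 1 / 2)) powr real n"
          by (simp add: powr_realpow)
        also have "\<dots> = (2 * pi) powr (- real n / 2)"
          unfolding powr_powr by simp
        finally show ?thesis ..
      qed
      moreover have "exp (- (norm_Rn n x)\<^sup>2 / 2) = (\<Prod>i<n. exp (- (x i)\<^sup>2 / 2))"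
        by (simp add: norm_Rn_power2 sum_negf sum_divide_distrib flip: exp_sum)
      ultimately show ?thesis
        by (simp add: std_normal_density_def prod_dividef power_divide)
    qed
    have "emeasure (gauss n) (Pi\<^sub>E {..<n} A)
        = (\<integral>\<^sup>+x. ennreal (\<Prod>i<n. std_normal_density (x i)) * indicator (Pi\<^sub>E {..<n} A) x
            \<partial>Pi\<^sub>M {..<n} (\<lambda>_. lborel))"
      unfolding gauss_def dens[symmetric] by (subst emeasure_density) auto
    also have "\<dots> = (\<integral>\<^sup>+x. (\<Prod>i<n. ennreal (std_normal_density (x i)) * indicator (A i) (x i))
            \<partial>Pi\<^sub>M {..<n} (\<lambda>_. lborel))"
    proof (rule nn_integral_cong)
      fix x assume "x \<in> space (Pi\<^sub>M {..<n} (\<lambda>_. lborel :: real measure))"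
      then have "indicator (Pi\<^sub>E {..<n} A) x = (\<Prod>i<n. indicator (A i) (x i) :: ennreal)"
        by (auto simp: space_PiM indicator_def PiE_iff intro: prod_zero)
      then show "ennreal (\<Prod>i<n. std_normal_density (x i)) * indicator (Pi\<^sub>E {..<n} A) x
          = (\<Prod>i<n. ennreal (std_normal_density (x i)) * indicator (A i) (x i))"
        by (simp add: prod.distrib prod_ennreal normal_density_nonneg)
    qed
    also have "\<dots> = (\<Prod>i<n. \<integral>\<^sup>+y. ennreal (std_normal_density y) * indicator (A i) y \<partial>lborel)"
      using A by (subst L.product_nn_integral_prod) auto
    also have "\<dots> = (\<Prod>i<n. emeasure std_normal_distribution (A i))"
      using A by (intro prod.cong) (auto simp: emeasure_density)
    finally show "emeasure (gauss n) (Pi\<^sub>E {..<n} A)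
        = (\<Prod>i\<in>{..<n}. emeasure std_normal_distribution (A i))" .
  qed simp
qed

lemma space_gauss: "space (gauss n) = Rn n"
  by (simp add: gauss_def space_PiM Rn_def)

lemma prob_space_gauss: "prob_space (gauss n)"
  unfolding gauss_eq_PiM by (intro prob_space_PiM prob_space_normal_density) simp

text \<open>\<open>merge\<close> identifies the product measure over \<open>{..<n + m}\<close> with
  the product of those over \<open>{..<n}\<close> and \<open>{n..<n + m}\<close>; its preimage of
  the set is a rectangle.\<close>

lemma measure_gauss_times:
  assumes A: "A \<in> sets (gauss n)" and D: "D \<in> sets (gauss m)"
  shows "measure (gauss (n + m)) (times_Rn n m A D)
    = measure (gauss n) A * measure (gauss m) D"
proof -
  let ?S = "std_normal_distribution" and ?J = "{n..<n + m}"
  let ?P = "\<lambda>I. Pi\<^sub>M I (\<lambda>_::nat. ?S)"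
  interpret S: prob_space ?S by (rule prob_space_normal_density) simp
  interpret product_sigma_finite "\<lambda>_::nat. ?S"
    by (simp add: product_sigma_finite_def S.sigma_finite_measure_axioms)
  interpret J: prob_space "?P ?J"
    by (intro prob_space_PiM S.prob_space_axioms)
  interpret G: prob_space "gauss k" for k by (rule prob_space_gauss)
  let ?t = "\<lambda>y. \<lambda>i\<in>{..<m}. y (n + i)"
  let ?D = "?t -` D \<inter> space (?P ?J)"
  have t: "?t \<in> ?P ?J \<rightarrow>\<^sub>M ?P {..<m}"
    by (intro measurable_restrict measurable_component_singleton) auto
  \<comment> \<open>All coordinates have the same distribution, so shifting the indices by
    \<open>n\<close> preserves the law.\<close>
  have shift: "distr (?P ?J) (?P {..<m}) ?t = ?P {..<m}"
    by (rule distr_PiM_reindex) (auto intro: S.prob_space_axioms)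
  have D': "?D \<in> sets (?P ?J)"
    using t D by (auto simp: gauss_eq_PiM intro: measurable_sets)
  have mD: "emeasure (?P ?J) ?D = emeasure (gauss m) D"
    using D t by (subst gauss_eq_PiM, subst shift[symmetric], subst emeasure_distr)
      (auto simp: gauss_eq_PiM)
  have un: "{..<n} \<union> ?J = {..<n + m}" by auto
  have AR: "A \<subseteq> {..<n} \<rightarrow>\<^sub>E UNIV"
    using sets.sets_into_space[OF A] by (simp add: space_gauss Rn_def)
  have T: "times_Rn n m A D \<in> sets (?P {..<n + m})"
  proof -
    have "(\<lambda>x. restrict x {..<n}) \<in> ?P {..<n + m} \<rightarrow>\<^sub>M ?P {..<n}"
      by (intro measurable_restrict measurable_component_singleton) auto
    moreover have "?t \<in> ?P {..<n + m} \<rightarrow>\<^sub>M ?P {..<m}"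
      by (intro measurable_restrict measurable_component_singleton) auto
    ultimately have "((\<lambda>x. restrict x {..<n}) -` A \<inter> space (?P {..<n + m}))
        \<inter> (?t -` D \<inter> space (?P {..<n + m})) \<in> sets (?P {..<n + m})"
      using A D unfolding gauss_eq_PiM by (intro sets.Int measurable_sets)
    also have "((\<lambda>x. restrict x {..<n}) -` A \<inter> space (?P {..<n + m}))
        \<inter> (?t -` D \<inter> space (?P {..<n + m})) = times_Rn n m A D"
      by (auto simp: times_Rn_def Rn_def space_PiM)
    finally show ?thesis .
  qed
  have "emeasure (gauss (n + m)) (times_Rn n m A D)
      = emeasure (distr (?P {..<n} \<Otimes>\<^sub>M ?P ?J) (?P ({..<n} \<union> ?J)) (merge {..<n} ?J)) (times_Rn n m A D)"
    by (subst distr_merge) (auto simp: gauss_eq_PiM un)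
  also have "\<dots> = emeasure (?P {..<n} \<Otimes>\<^sub>M ?P ?J)
      (merge {..<n} ?J -` times_Rn n m A D \<inter> space (?P {..<n} \<Otimes>\<^sub>M ?P ?J))"
    using T by (intro emeasure_distr measurable_merge) (simp add: un)
  also have "merge {..<n} ?J -` times_Rn n m A D \<inter> space (?P {..<n} \<Otimes>\<^sub>M ?P ?J) = A \<times> ?D"
  proof -
    have 1: "restrict (merge {..<n} ?J (x, y)) {..<n} = x"
      if "x \<in> {..<n} \<rightarrow>\<^sub>E UNIV" for x y :: "nat \<Rightarrow> real"
      using that by (auto simp: merge_def fun_eq_iff PiE_def extensional_def)
    have 2: "?t (merge {..<n} ?J (x, y)) = ?t y" for x y :: "nat \<Rightarrow> real"
      by (auto simp: merge_def)
    have 3: "merge {..<n} ?J (x, y) \<in> Rn (n + m)" for x y :: "nat \<Rightarrow> real"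
      by (auto simp: merge_def Rn_def PiE_def extensional_def)
    show ?thesis
      using AR by (auto simp: times_Rn_def space_pair_measure space_PiM 1 2 3)
  qed
  also have "emeasure (?P {..<n} \<Otimes>\<^sub>M ?P ?J) (A \<times> ?D)
      = emeasure (gauss n) A * emeasure (gauss m) D"
    using A D' by (subst J.emeasure_pair_measure_Times) (simp_all add: mD gauss_eq_PiM)
  finally show ?thesis
    by (simp add: measure_def enn2real_mult)
qed

section \<open>Closure properties of \<open>sym_convex\<close> and inclusions between balls\<close>

text \<open>Negation is an involution on \<open>Rn n\<close>, so one inclusion suffices. In this
  form symmetry passes directly to intersections and products.\<close>

lemma symmetric_Rn_iff:
  assumes "A \<subseteq> Rn n"
  shows "symmetric_Rn n A \<longleftrightarrow> (\<forall>x\<in>A. scale_Rn n (- 1) x \<in> A)"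
proof
  assume "symmetric_Rn n A"
  then show "\<forall>x\<in>A. scale_Rn n (- 1) x \<in> A"
    unfolding symmetric_Rn_def by blast
next
  assume *: "\<forall>x\<in>A. scale_Rn n (- 1) x \<in> A"
  have "x = scale_Rn n (- 1) (scale_Rn n (- 1) x)" if "x \<in> A" for x
    using that assms by (auto simp: scale_Rn_def Rn_def fun_eq_iff PiE_def extensional_def)
  with * show "symmetric_Rn n A"
    unfolding symmetric_Rn_def by blast
qed

lemma closedin_sqball: "closedin (powertop_real {..<n}) (sqball_Rn n s)"
proof -
  have "continuous_map (powertop_real {..<n}) euclideanreal (\<lambda>x. \<Sum>i<n. (x i)\<^sup>2)"
    by (intro continuous_map_sum continuous_map_real_pow continuous_map_product_projection) auto
  from closedin_continuous_map_preimage[OF this, of "{..s}"]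
  show ?thesis by (simp add: sqball_Rn_def norm_Rn_power2 Rn_def)
qed

lemma sqball_sym_convex: "sqball_Rn n s \<in> sym_convex n"
proof -
  have "convex_Rn n (sqball_Rn n s)"
    unfolding convex_Rn_def
  proof (intro ballI allI impI)
    fix x y u v :: _ assume x: "x \<in> sqball_Rn n s" and y: "y \<in> sqball_Rn n s"
      and uv: "u \<ge> 0" "v \<ge> 0" "u + v = (1::real)"
    \<comment> \<open>Convexity of the square, with defect \<open>u * v * (a - b)\<^sup>2\<close>.
      Summed over the coordinates it makes the squared norm convex, hence also its sublevel
      sets.\<close>
    have "(u * a + v * b)\<^sup>2 \<le> u * a\<^sup>2 + v * b\<^sup>2" for a b :: real
    proof -
      have v: "v = 1 - u" using uv by simp
      have "u * a\<^sup>2 + v * b\<^sup>2 - (u * a + v * b)\<^sup>2 = u * v * (a - b)\<^sup>2"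
        unfolding v by (simp add: power2_eq_square algebra_simps)
      then show ?thesis using uv by (smt (verit) mult_nonneg_nonneg zero_le_power2)
    qed
    then have "(\<Sum>i<n. (u * x i + v * y i)\<^sup>2) \<le> (\<Sum>i<n. u * (x i)\<^sup>2 + v * (y i)\<^sup>2)"
      by (intro sum_mono)
    also have "\<dots> = u * (\<Sum>i<n. (x i)\<^sup>2) + v * (\<Sum>i<n. (y i)\<^sup>2)"
      by (simp add: sum.distrib sum_distrib_left)
    also have "\<dots> \<le> u * s + v * s"
      using x y uv by (intro add_mono mult_left_mono) (auto simp: sqball_Rn_def norm_Rn_power2)
    also have "\<dots> = s" using uv by (simp flip: distrib_right)
    finally show "add_Rn n (scale_Rn n u x) (scale_Rn n v y) \<in> sqball_Rn n s"
      by (auto simp: sqball_Rn_def norm_Rn_power2 add_Rn_def scale_Rn_def Rn_def)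
  qed
  moreover have "symmetric_Rn n (sqball_Rn n s)"
    by (subst symmetric_Rn_iff) (auto simp: sqball_Rn_def norm_Rn_power2 scale_Rn_def Rn_def)
  ultimately show ?thesis by (simp add: sym_convex_def closedin_sqball)
qed

lemma sym_convex_subset: "A \<in> sym_convex n \<Longrightarrow> A \<subseteq> Rn n"
  using closedin_subset[of "powertop_real {..<n}" A] by (simp add: sym_convex_def Rn_def)

lemma sym_convex_sets: "A \<in> sym_convex n \<Longrightarrow> A \<in> sets (gauss n)"
  by (simp add: sym_convex_def closedin_sets_gauss)

lemma sym_convex_Int:
  assumes A: "A \<in> sym_convex n" and B: "B \<in> sym_convex n"
  shows "A \<inter> B \<in> sym_convex n"
proof -
  have "A \<subseteq> Rn n" "B \<subseteq> Rn n" "A \<inter> B \<subseteq> Rn n" using A B sym_convex_subset by blast+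
  note * = this[THEN symmetric_Rn_iff]
  show ?thesis using A B unfolding sym_convex_def mem_Collect_eq convex_Rn_def * by blast
qed

text \<open>The product is the intersection of the preimages of \<open>A\<close> and
  \<open>D\<close> under the two coordinate projections, which are continuous and linear.\<close>

lemma sym_convex_times:
  assumes A: "A \<in> sym_convex n" and D: "D \<in> sym_convex m"
  shows "times_Rn n m A D \<in> sym_convex (n + m)"
proof -
  let ?r = "\<lambda>x. restrict x {..<n}" and ?t = "\<lambda>x. \<lambda>i\<in>{..<m}. x (n + i)"
  have "A \<subseteq> Rn n" "D \<subseteq> Rn m" "times_Rn n m A D \<subseteq> Rn (n + m)"
    using A D sym_convex_subset by (auto simp: times_Rn_def)
  note sym = this[THEN symmetric_Rn_iff]
  have r: "continuous_map (powertop_real {..<n + m}) (powertop_real {..<n}) ?r"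
    by (auto simp: continuous_map_componentwise intro!: continuous_map_product_projection)
  have t: "continuous_map (powertop_real {..<n + m}) (powertop_real {..<m}) ?t"
    by (auto simp: continuous_map_componentwise intro!: continuous_map_product_projection)
  have "closedin (powertop_real {..<n + m})
      ({x \<in> topspace (powertop_real {..<n + m}). ?r x \<in> A}
       \<inter> {x \<in> topspace (powertop_real {..<n + m}). ?t x \<in> D})"
    using A D by (intro closedin_Int closedin_continuous_map_preimage[OF r]
        closedin_continuous_map_preimage[OF t]) (auto simp: sym_convex_def)
  also have "{x \<in> topspace (powertop_real {..<n + m}). ?r x \<in> A}
       \<inter> {x \<in> topspace (powertop_real {..<n + m}). ?t x \<in> D} = times_Rn n m A D"
    by (auto simp: times_Rn_def Rn_def)
  finally have cl: "closedin (powertop_real {..<n + m}) (times_Rn n m A D)" .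
  have lin: "?r (scale_Rn (n + m) c x) = scale_Rn n c (?r x)"
       "?t (scale_Rn (n + m) c x) = scale_Rn m c (?t x)"
       "?r (add_Rn (n + m) x y) = add_Rn n (?r x) (?r y)"
       "?t (add_Rn (n + m) x y) = add_Rn m (?t x) (?t y)"
       "scale_Rn (n + m) c x \<in> Rn (n + m)" "add_Rn (n + m) x y \<in> Rn (n + m)" for c x y
    by (auto simp: scale_Rn_def add_Rn_def Rn_def)
  have cv: "convex_Rn (n + m) (times_Rn n m A D)"
    using A D unfolding sym_convex_def mem_Collect_eq convex_Rn_def times_Rn_def
    by (simp add: lin)
  have "symmetric_Rn (n + m) (times_Rn n m A D)"
    using A D unfolding sym_convex_def mem_Collect_eq sym unfolding times_Rn_def
    by (simp add: lin)
  with cl cv show ?thesis by (simp add: sym_convex_def)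
qed

lemma Rn_sym_convex: "Rn n \<in> sym_convex n"
  using closedin_topspace[of "powertop_real {..<n}"]
  by (auto simp: sym_convex_def convex_Rn_def symmetric_Rn_iff add_Rn_def scale_Rn_def Rn_def)

lemma times_Rn_Int: "times_Rn n m A D \<inter> times_Rn n m B E = times_Rn n m (A \<inter> B) (D \<inter> E)"
  by (auto simp: times_Rn_def)

text \<open>Brings \<open>sqball_Rn\<close> into the scaled unit ball form that the hypothesis of
  \<open>corollary7\<close> uses.\<close>

lemma sqball_subset_scale:
  assumes "n \<ge> 1"
  shows "sqball_Rn n (real n) \<subseteq> scale_Rn n (sqrt (real n)) ` ball_Rn n"
proof
  fix x assume x: "x \<in> sqball_Rn n (real n)"
  let ?y = "scale_Rn n (1 / sqrt (real n)) x"
  have "x = scale_Rn n (sqrt (real n)) ?y"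
    using x assms by (auto simp: sqball_Rn_def scale_Rn_def Rn_def fun_eq_iff PiE_def extensional_def)
  moreover have "?y \<in> ball_Rn n"
  proof -
    have "(norm_Rn n ?y)\<^sup>2 = (norm_Rn n x)\<^sup>2 / real n"
      by (simp add: norm_Rn_power2 scale_Rn_def power_divide sum_divide_distrib)
    also have "\<dots> \<le> 1\<^sup>2" using x assms by (simp add: sqball_Rn_def)
    finally have "norm_Rn n ?y \<le> 1" by (rule power2_le_imp_le) simp
    then show ?thesis by (simp add: ball_Rn_def Rn_def scale_Rn_def)
  qed
  ultimately show "x \<in> scale_Rn n (sqrt (real n)) ` ball_Rn n" by blast
qed

text \<open>Pythagoras: the squared norms of the two blocks of coordinates add up.\<close>

lemma times_sqball_subset:
  "times_Rn n m (sqball_Rn n r) (sqball_Rn m s) \<subseteq> sqball_Rn (n + m) (r + s)"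
proof
  fix x assume x: "x \<in> times_Rn n m (sqball_Rn n r) (sqball_Rn m s)"
  have "(\<Sum>i<n + m. (x i)\<^sup>2) = (\<Sum>i<n. (x i)\<^sup>2) + (\<Sum>i<m. (x (n + i))\<^sup>2)"
    by (induction m) (simp_all add: add.assoc)
  moreover have "(\<Sum>i<n. (x i)\<^sup>2) = (norm_Rn n (restrict x {..<n}))\<^sup>2"
      "(\<Sum>i<m. (x (n + i))\<^sup>2) = (norm_Rn m (\<lambda>i\<in>{..<m}. x (n + i)))\<^sup>2"
    by (simp_all add: norm_Rn_power2)
  ultimately show "x \<in> sqball_Rn (n + m) (r + s)"
    using x unfolding times_Rn_def sqball_Rn_def norm_Rn_power2[of "n + m"] by auto
qed

section \<open>Gaussian measure of balls whose squared radius is near the dimension\<close>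

text \<open>As the density is positive, a null set is Lebesgue null, but the half-line contains an
  interval of length 1.\<close>

lemma measure_std_normal_atMost_pos: "measure std_normal_distribution {..a} > 0"
proof -
  interpret S: prob_space std_normal_distribution
    by (rule prob_space_normal_density) simp
  have "{..a} \<notin> null_sets std_normal_distribution"
  proof
    assume "{..a} \<in> null_sets std_normal_distribution"
    then have "AE x in lborel. x \<notin> {..a}"
      using normal_density_pos[of 1 0]
      by (subst (asm) null_sets_density_iff) (auto simp: ennreal_eq_0_iff not_le[symmetric])
    then have "emeasure lborel {..a} = 0"
      by (subst (asm) AE_iff_measurable[of "{..a}"]) auto
    moreover have "emeasure lborel {a - 1..a} \<le> emeasure lborel {..a}"
      by (intro emeasure_mono) auto
    ultimately show False by simp
  qed
  then show ?thesis
    by (simp add: null_sets_def S.emeasure_eq_measure zero_less_measure_iff)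
qed

text \<open>Points are Lebesgue null, so there are no atoms. Weak convergence controls distribution
  functions only at continuity points of the limit.\<close>

lemma isCont_cdf_std_normal: "isCont (cdf std_normal_distribution) x"
proof -
  interpret S: real_distribution std_normal_distribution
    by (rule real_dist_normal_dist)
  have "{x} \<in> null_sets std_normal_distribution"
  proof (subst null_sets_density_iff)
    have "AE y in lborel. y \<in> {x} \<longrightarrow> ennreal (std_normal_density y) = 0"
      using AE_lborel_singleton[of x] by eventually_elim simp
    then show "{x} \<in> sets lborel \<and> (AE y in lborel. y \<in> {x} \<longrightarrow> ennreal (std_normal_density y) = 0)"
      by simp
  qed simp
  then show ?thesis
    by (simp add: S.isCont_cdf null_sets_def measure_def)
qed

text \<open>These moments give \<open>x\<^sup>2 - 1\<close> mean 0 and variance 3 - 2 + 1 = 2, the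
  data for the central limit theorem.\<close>

lemma integral_std_normal_power4_power2:
  "(LINT x|std_normal_distribution. x ^ 4) = 3" "(LINT x|std_normal_distribution. x\<^sup>2) = 1"
  using std_normal_distribution_even_moments(1)[of 2] std_normal_distribution_even_moments(1)[of 1]
  by (simp_all add: fact_numeral)

text \<open>By the central limit theorem, \<open>(\<bar>x\<bar>\<^sup>2 - m) / sqrt (2 m)\<close> is asymptotically normal, so it
  is below \<open>-1\<close> with a probability bounded away from zero, and \<open>sqrt (2 m)\<close> exceeds any \<open>a\<close>.\<close>

lemma gauss_sqball_lower_bound:
  "\<exists>c>0. \<forall>a. \<forall>\<^sub>F m in sequentially. c \<le> measure (gauss m) (sqball_Rn m (real m - a))"
proof -
  let ?S = "std_normal_distribution"
  \<comment> \<open>The infinite product carries an i.i.d. sequence on a single space, to which the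
    central limit theorem applies; the first \<open>m\<close> coordinates have law
    \<open>gauss m\<close>.\<close>
  let ?M = "Pi\<^sub>M UNIV (\<lambda>_::nat. ?S)"
  define X where "X i w = (w i)\<^sup>2 - (1::real)" for i :: nat and w :: "nat \<Rightarrow> real"
  let ?Y = "\<lambda>m w. (\<Sum>i<m. X i w) / sqrt (real m * (sqrt 2)\<^sup>2)"
  interpret S: prob_space ?S by (rule prob_space_normal_density) simp
  interpret M: prob_space ?M by (intro prob_space_PiM S.prob_space_axioms)
  have coord: "distr ?M ?S (\<lambda>w. w i) = ?S" for i
    by (rule distr_PiM_component) (auto intro: S.prob_space_axioms)
  have [measurable]: "(\<lambda>w. w i) \<in> ?M \<rightarrow>\<^sub>M borel" for i
    using measurable_component_singleton[of i UNIV "\<lambda>_. ?S"] by simp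
  have [measurable]: "X i \<in> borel_measurable ?M" for i
    unfolding X_def by measurable
  have int: "integrable ?M (\<lambda>w. f (w i))" "M.expectation (\<lambda>w. f (w i)) = (LINT x|?S. f x)"
    if "integrable ?S f" for f :: "real \<Rightarrow> real" and i
  proof -
    have f: "f \<in> borel_measurable ?S" and m: "(\<lambda>w. w i) \<in> ?M \<rightarrow>\<^sub>M ?S" using that by auto
    show "integrable ?M (\<lambda>w. f (w i))"
      using that integrable_distr_eq[OF m f] by (simp only: coord)
    show "M.expectation (\<lambda>w. f (w i)) = (LINT x|?S. f x)"
      using integral_distr[OF m f] by (simp only: coord)
  qed
  note mom[simp] = integrable_std_normal_distribution_moment
  have mean: "M.expectation (X i) = 0" for i
    using int(2)[of "\<lambda>x. x\<^sup>2 - 1" i]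
    by (simp add: X_def[abs_def] integral_std_normal_power4_power2 S.prob_space[simplified])
  have sq: "(x\<^sup>2 - 1)\<^sup>2 = x ^ 4 - 2 * x\<^sup>2 + 1" for x :: real
    by (simp add: power2_diff flip: power_mult)
  have X2: "integrable ?M (\<lambda>w. (X i w)\<^sup>2)" "M.expectation (\<lambda>w. (X i w)\<^sup>2) = 2" for i
    using int[of "\<lambda>x. (x\<^sup>2 - 1)\<^sup>2" i]
    by (simp_all add: X_def sq integral_std_normal_power4_power2 S.prob_space[simplified])
  \<comment> \<open>The coordinates are independent because their joint law, that of the identity
    map, is the product of the marginals.\<close>
  have "M.indep_vars (\<lambda>_. ?S) (\<lambda>i w. w i) UNIV"
    by (subst M.indep_vars_iff_distr_eq_PiM') (auto simp: coord restrict_UNIV distr_id2)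
  then have "M.indep_vars (\<lambda>_. borel) X UNIV"
    unfolding X_def[abs_def] by (rule M.indep_vars_compose2) auto
  moreover have "distr ?M borel (X i) = distr ?S borel (\<lambda>x. x\<^sup>2 - 1)" for i
    by (subst coord[of i, symmetric], subst distr_distr) (auto simp: X_def[abs_def] comp_def)
  ultimately have clt: "weak_conv_m (\<lambda>m. distr ?M borel (?Y m)) ?S"
    using X2 mean by (intro M.central_limit_theorem_zero_mean) auto
  \<comment> \<open>Half of the limiting probability: the probabilities eventually exceed it. It is
    fixed before \<open>a\<close>.\<close>
  define c where "c = measure ?S {..-1} / 2"
  have c: "c > 0" using measure_std_normal_atMost_pos[of "-1"] by (simp add: c_def)
  have "(\<lambda>m. measure (distr ?M borel (?Y m)) {..-1}) \<longlonglongrightarrow> measure ?S {..-1}"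
    using clt isCont_cdf_std_normal[of "-1"]
    by (simp add: weak_conv_m_def weak_conv_def cdf_def)
  moreover have "c < measure ?S {..-1}" using c by (simp add: c_def)
  ultimately have ev: "\<forall>\<^sub>F m in sequentially. c < measure (distr ?M borel (?Y m)) {..-1}"
    by (rule order_tendstoD)
  have "\<forall>\<^sub>F m in sequentially. c \<le> measure (gauss m) (sqball_Rn m (real m - a))" for a
  proof -
    \<comment> \<open>As \<open>a\<close> is fixed, one standard deviation
      \<open>sqrt (2 * real m)\<close> of the squared norm eventually exceeds it.\<close>
    have "filterlim (\<lambda>m. sqrt (2 * real m)) at_top sequentially"
      by real_asymp
    then have "\<forall>\<^sub>F m in sequentially. a \<le> sqrt (2 * real m)"
      by (auto simp: filterlim_at_top)
    with ev eventually_gt_at_top[of 0] show ?thesis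
    proof eventually_elim
      case (elim m)
      let ?r = "\<lambda>w. \<lambda>i\<in>{..<m}. w i :: real"
      have r: "?r \<in> ?M \<rightarrow>\<^sub>M Pi\<^sub>M {..<m} (\<lambda>_. ?S)"
        by (intro measurable_restrict measurable_component_singleton) auto
      have G: "gauss m = distr ?M (Pi\<^sub>M {..<m} (\<lambda>_. ?S)) ?r"
        unfolding gauss_eq_PiM
        by (rule distr_PiM_reindex[symmetric]) (auto intro: S.prob_space_axioms)
      have B: "sqball_Rn m (real m - a) \<in> sets (Pi\<^sub>M {..<m} (\<lambda>_. ?S))"
        using sym_convex_sets[OF sqball_sym_convex] by (simp add: gauss_eq_PiM)
      \<comment> \<open>\<open>?Y m w \<le> -1\<close> says that the squared norm is at most
        \<open>m - sqrt (2 * m)\<close>, which is at most \<open>m - a\<close>.\<close>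
      have sub: "?Y m -` {..-1} \<inter> space ?M \<subseteq> ?r -` sqball_Rn m (real m - a) \<inter> space ?M"
      proof
        fix w assume w: "w \<in> ?Y m -` {..-1} \<inter> space ?M"
        then have "(\<Sum>i<m. X i w) \<le> - sqrt (2 * real m)"
          using elim by (simp add: divide_le_eq mult.commute)
        then have "(\<Sum>i<m. (w i)\<^sup>2) \<le> real m - a"
          using elim by (simp add: X_def sum_subtractf)
        with w show "w \<in> ?r -` sqball_Rn m (real m - a) \<inter> space ?M"
          by (simp add: sqball_Rn_def norm_Rn_power2 Rn_def)
      qed
      have "measure (distr ?M borel (?Y m)) {..-1} = M.prob (?Y m -` {..-1} \<inter> space ?M)"
        by (rule measure_distr) auto
      also have "\<dots> \<le> M.prob (?r -` sqball_Rn m (real m - a) \<inter> space ?M)"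
        by (rule M.finite_measure_mono[OF sub measurable_sets[OF r B]])
      also have "\<dots> = measure (gauss m) (sqball_Rn m (real m - a))"
        unfolding G by (rule measure_distr[OF r B, symmetric])
      finally show ?case using elim by simp
    qed
  qed
  with c show ?thesis by blast
qed

section \<open>The correlation inequality up to a constant\<close>

text \<open>Truncating \<open>A\<close> and \<open>B\<close> at squared radius \<open>r\<close>
  bounds the first \<open>n\<close> coordinates, so a product of balls fits into the large ball. The
  ball bound is used once for each set, hence \<open>c\<^sup>2\<close>, which does not depend on
  \<open>r\<close>; then \<open>r\<close> tends to infinity.\<close>

lemma gauss_correlation_up_to_constant:
  assumes H: "\<forall>n\<ge>1. \<forall>A\<in>sym_convex n. \<forall>B\<in>sym_convex n.
      A \<subseteq> scale_Rn n (sqrt (real n)) ` ball_Rn n \<longrightarrow>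
      B \<subseteq> scale_Rn n (sqrt (real n)) ` ball_Rn n \<longrightarrow>
      measure (gauss n) (A \<inter> B) \<ge> measure (gauss n) A * measure (gauss n) B"
  shows "\<exists>c>0. \<forall>n\<ge>1. \<forall>A\<in>sym_convex n. \<forall>B\<in>sym_convex n.
      c * (measure (gauss n) A * measure (gauss n) B) \<le> measure (gauss n) (A \<inter> B)"
proof -
  obtain c where c: "c > 0"
    and ball: "\<And>a. \<forall>\<^sub>F m in sequentially. c \<le> measure (gauss m) (sqball_Rn m (real m - a))"
    using gauss_sqball_lower_bound by blast
  interpret G: prob_space "gauss k" for k by (rule prob_space_gauss)
  have "c\<^sup>2 * (measure (gauss n) A * measure (gauss n) B) \<le> measure (gauss n) (A \<inter> B)"
    if n: "n \<ge> 1" and A: "A \<in> sym_convex n" and B: "B \<in> sym_convex n" for n A B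
  proof -
    let ?T = "\<lambda>A r. measure (gauss n) (A \<inter> sqball_Rn n r)"
    have bounded: "c\<^sup>2 * (?T A r * ?T B r) \<le> measure (gauss n) (A \<inter> B)" for r
    proof -
      \<comment> \<open>The shift \<open>r - n\<close> makes the squared radii \<open>r\<close> and
        \<open>m - (r - n)\<close> add up to \<open>n + m\<close>.\<close>
      obtain m where m: "c \<le> measure (gauss m) (sqball_Rn m (real m - (r - real n)))"
        using eventually_happens'[OF _ ball] by (meson sequentially_bot)
      define N where "N = n + m"
      \<comment> \<open>The cylinder over the set, cut by the ball of squared radius
        \<open>N\<close> so that the hypothesis applies in dimension \<open>N\<close>.\<close>
      define ext where "ext A = times_Rn n m A (Rn m) \<inter> sqball_Rn N (real N)" for A
      have ext: "ext D \<in> sym_convex N" "c * ?T D r \<le> measure (gauss N) (ext D)"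
        if D: "D \<in> sym_convex n" for D
      proof -
        show sc: "ext D \<in> sym_convex N"
          unfolding ext_def N_def
          by (intro sym_convex_Int sym_convex_times D Rn_sym_convex sqball_sym_convex)
        have "c * ?T D r \<le> ?T D r * measure (gauss m) (sqball_Rn m (real m - (r - real n)))"
          using m by (subst mult.commute) (intro mult_left_mono, auto)
        also have "\<dots> = measure (gauss N)
            (times_Rn n m (D \<inter> sqball_Rn n r) (sqball_Rn m (real m - (r - real n))))"
          unfolding N_def
          by (intro measure_gauss_times[symmetric] sym_convex_sets sym_convex_Int D sqball_sym_convex)
        also have "\<dots> \<le> measure (gauss N) (ext D)"
        proof (rule G.finite_measure_mono)
          show "ext D \<in> G.events N" by (rule sym_convex_sets[OF sc])
          have "times_Rn n m (sqball_Rn n r) (sqball_Rn m (real m - (r - real n)))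
              \<subseteq> sqball_Rn N (real N)"
            using times_sqball_subset[of n m r "real m - (r - real n)"]
            by (simp add: N_def add.commute)
          then show "times_Rn n m (D \<inter> sqball_Rn n r) (sqball_Rn m (real m - (r - real n))) \<subseteq> ext D"
            by (auto simp: ext_def times_Rn_def sqball_Rn_def)
        qed
        finally show "c * ?T D r \<le> measure (gauss N) (ext D)" .
      qed
      have "c\<^sup>2 * (?T A r * ?T B r) = (c * ?T A r) * (c * ?T B r)"
        by (simp add: power2_eq_square)
      also have "\<dots> \<le> measure (gauss N) (ext A) * measure (gauss N) (ext B)"
        using c by (intro mult_mono ext A B) auto
      also have "\<dots> \<le> measure (gauss N) (ext A \<inter> ext B)"
        using H[rule_format, OF _ ext(1)[OF A] ext(1)[OF B]] sqball_subset_scale[of N] n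
        by (auto simp: ext_def N_def)
      \<comment> \<open>Dropping the ball leaves the cylinder over \<open>A \<inter> B\<close>,
        which has the measure of its base since \<open>gauss m\<close> has total mass 1.\<close>
      also have "\<dots> \<le> measure (gauss N) (times_Rn n m (A \<inter> B) (Rn m))"
      proof (rule G.finite_measure_mono)
        show "times_Rn n m (A \<inter> B) (Rn m) \<in> G.events N"
          unfolding N_def
          by (intro sym_convex_sets sym_convex_times sym_convex_Int A B Rn_sym_convex)
      qed (auto simp: ext_def times_Rn_def)
      also have "\<dots> = measure (gauss n) (A \<inter> B)"
        using measure_gauss_times[of "A \<inter> B" n "Rn m" m] G.prob_space[of m] A B
        by (simp add: N_def space_gauss sym_convex_sets sym_convex_Int Rn_sym_convex)
      finally show ?thesis .
    qed
    \<comment> \<open>Continuity from below: the balls exhaust \<open>Rn n\<close>. The upper bound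
      in \<open>bounded\<close> is free of \<open>r\<close>, so the truncation disappears in the
      limit.\<close>
    have lim: "(\<lambda>k. ?T D (real k)) \<longlonglongrightarrow> measure (gauss n) D" if D: "D \<in> sym_convex n" for D
    proof -
      have "incseq (\<lambda>k. D \<inter> sqball_Rn n (real k))"
        by (auto simp: incseq_def sqball_Rn_def)
      moreover have "range (\<lambda>k. D \<inter> sqball_Rn n (real k)) \<subseteq> sets (gauss n)"
        by (auto intro!: sym_convex_sets sym_convex_Int D sqball_sym_convex)
      moreover have "(\<Union>k. D \<inter> sqball_Rn n (real k)) = D"
        using sym_convex_subset[OF D] by (auto simp: sqball_Rn_def real_arch_simple)
      ultimately show ?thesis
        using G.finite_Lim_measure_incseq[of "\<lambda>k. D \<inter> sqball_Rn n (real k)" n] by simp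
    qed
    show ?thesis
      by (rule LIMSEQ_le_const2[OF tendsto_mult_left[OF tendsto_mult[OF lim[OF A] lim[OF B]]]])
        (use bounded in blast)
  qed
  moreover have "c\<^sup>2 > 0" using c by simp
  ultimately show ?thesis by blast
qed

section \<open>Removal of the constant by taking powers\<close>

text \<open>Passing to the squares of \<open>A\<close> and \<open>B\<close> in dimension
  \<open>n + n\<close> squares all three measures and leaves \<open>c\<close> unchanged. Iterated
  doubling produces the exponents \<open>2 ^ j\<close>, so \<open>n\<close>, \<open>A\<close> and
  \<open>B\<close> vary in the induction.\<close>

lemma correlation_power:
  assumes "\<forall>n\<ge>1. \<forall>A\<in>sym_convex n. \<forall>B\<in>sym_convex n.
      c * (measure (gauss n) A * measure (gauss n) B) \<le> measure (gauss n) (A \<inter> B)"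
    and "n \<ge> 1" "A \<in> sym_convex n" "B \<in> sym_convex n"
  shows "c * (measure (gauss n) A * measure (gauss n) B) ^ (2 ^ j)
    \<le> measure (gauss n) (A \<inter> B) ^ (2 ^ j)"
  using assms(2-)
proof (induction j arbitrary: n A B)
  case 0
  then show ?case using assms(1) by simp
next
  case (Suc j)
  have sq: "measure (gauss (n + n)) (times_Rn n n D D) = (measure (gauss n) D)\<^sup>2"
    if "D \<in> sym_convex n" for D
    using that by (simp add: measure_gauss_times sym_convex_sets power2_eq_square)
  have dbl: "x ^ (2 ^ Suc j) = (x\<^sup>2) ^ (2 ^ j)" for x :: real
    by (simp only: power_Suc power_mult)
  have "c * ((measure (gauss n) A)\<^sup>2 * (measure (gauss n) B)\<^sup>2) ^ (2 ^ j)
      \<le> ((measure (gauss n) (A \<inter> B))\<^sup>2) ^ (2 ^ j)"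
    using Suc.IH[of "n + n" "times_Rn n n A A" "times_Rn n n B B"] Suc.prems
    by (simp add: sym_convex_times times_Rn_Int sq sym_convex_Int)
  then show ?case
    by (simp only: dbl power_mult_distrib)
qed

text \<open>If \<open>q < p\<close>, the powers of \<open>q / p\<close> tend to 0 and fall below
  \<open>c\<close>.\<close>

lemma le_of_mult_power_le:
  fixes p q c :: real
  assumes c: "c > 0" and p: "p \<ge> 0" and q: "q \<ge> 0" and le: "\<And>j::nat. c * p ^ (2 ^ j) \<le> q ^ (2 ^ j)"
  shows "p \<le> q"
proof (rule ccontr)
  assume "\<not> p \<le> q"
  then have qp: "q < p" "p > 0" using q by auto
  obtain k where k: "(q / p) ^ k < c"
    using real_arch_pow_inv[OF c, of "q / p"] qp by auto
  \<comment> \<open>Since \<open>k \<le> 2 ^ k\<close> and the base lies in [0, 1], the exponent can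
    be enlarged to one covered by \<open>le\<close>.\<close>
  have "(q / p) ^ (2 ^ k) \<le> (q / p) ^ k"
    using qp q by (intro power_decreasing) (auto intro: less_imp_le)
  moreover have "c \<le> (q / p) ^ (2 ^ k)"
    using le[of k] qp by (simp add: power_divide le_divide_eq)
  ultimately show False using k by simp
qed

theorem corollary7:
  assumes "\<forall>n\<ge>1. \<forall>A\<in>sym_convex n. \<forall>B\<in>sym_convex n.
      A \<subseteq> scale_Rn n (sqrt (real n)) ` ball_Rn n \<longrightarrow>
      B \<subseteq> scale_Rn n (sqrt (real n)) ` ball_Rn n \<longrightarrow>
      measure (gauss n) (A \<inter> B) \<ge> measure (gauss n) A * measure (gauss n) B"
  shows "\<forall>n\<ge>1. \<forall>A\<in>sym_convex n. \<forall>B\<in>sym_convex n.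
      measure (gauss n) (A \<inter> B) \<ge> measure (gauss n) A * measure (gauss n) B"
proof (intro allI impI ballI)
  fix n :: nat and A B
  assume *: "n \<ge> 1" "A \<in> sym_convex n" "B \<in> sym_convex n"
  \<comment> \<open>The same \<open>c\<close> serves all dimensions, which lets
    \<open>correlation_power\<close> double the dimension repeatedly.\<close>
  obtain c where c: "c > 0" and up: "\<forall>n\<ge>1. \<forall>A\<in>sym_convex n. \<forall>B\<in>sym_convex n.
      c * (measure (gauss n) A * measure (gauss n) B) \<le> measure (gauss n) (A \<inter> B)"
    using gauss_correlation_up_to_constant[OF assms] by blast
  show "measure (gauss n) (A \<inter> B) \<ge> measure (gauss n) A * measure (gauss n) B"
    by (rule le_of_mult_power_le[OF c _ _ correlation_power[OF up *]]) simp_all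
qed

end
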